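(* Let $n\ge k\ge 2$ and let $G$ be a connected $k$-uniform linear hypergraph with vertex set $[n]$. Let $\gamma(G)=\max\{\rho(G-v): v\in[n]\}$ and let $\delta(G)$ be the minimum degree of $G$. Then $$\gamma(G)\ \ge\ \rho(G)-\sqrt[k-1]{\frac{\delta(G)}{\rho(G)}}\ \ge\ \rho(G)-1,$$ and either of these lower bounds for $\gamma(G)$ is attained if and only if $G$ is a Steiner system $S(2,k,n)$; that is, $\gamma(G)=\rho(G)-\sqrt[k-1]{\delta(G)/\rho(G)}$ if and only if $G$ is a Steiner system $S(2,k,n)$, and $\gamma(G)=\rho(G)-1$ if and only if $G$ is a Steiner system $S(2,k,n)$.
   Context: $[n]=\{1,\dots,n\}$. A $k$-uniform hypergraph $G$ has vertex set $V(G)$ and edge set $E(G)$ consisting of $k$-element subsets of $V(G)$; it is linear if every two distinct edges intersect in at most one vertex. The degree of a vertex is the number of edges containing it. The adjacency tensor $\mathcal{A}(G)=(a_{i_1\dots i_k})$ has order $k$ and dimension $|V(G)|$, with $a_{i_1\dots i_k}=\frac{1}{(k-1)!}$ if $\{i_1,\dots,i_k\}\in E(G)$ and $0$ otherwise. A complex number $\lambda$ is an eigenvalue of $\mathcal{A}(G)$ with eigenvector $\mathbf{x}\ne 0$ if $\lambda x_u^{k-1}=\sum_{e\in E(G),\,u\in e}\prod_{w\in e\setminus\{u\}}x_w$ for all $u\in V(G)$. The spectral radius $\rho(G)$ is the largest modulus of the eigenvalues of $\mathcal{A}(G)$ (equal to its largest H-eigenvalue, i.e. largest real eigenvalue with a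 real eigenvector). $G-v$ is the hypergraph with vertex set $V(G)\setminus\{v\}$ whose edges are the edges of $G$ not containing $v$. A Steiner system $S(2,k,n)$ (with $n\ge k\ge 2$) is a $k$-uniform hypergraph on $n$ vertices such that every $2$-element vertex subset is contained in precisely one edge. *)

theory Defs
  imports Complex_Main "HOL-Combinatorics.Multiset_Permutations"
begin

record 'a hypergraph =
  verts :: "'a set"
  edges :: "'a set set"

definition k_uniform :: "nat \<Rightarrow> 'a hypergraph \<Rightarrow> bool" where
  "k_uniform k G \<longleftrightarrow> finite (verts G) \<and> (\<forall>e\<in>edges G. e \<subseteq> verts G \<and> card e = k)"

definition linear_hypergraph :: "'a hypergraph \<Rightarrow> bool" where
  "linear_hypergraph G \<longleftrightarrow>
     (\<forall>e\<in>edges G. \<forall>f\<in>edges G. e \<noteq> f \<longrightarrow> card (e \<inter> f) \<le> 1)"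

definition adjacency :: "'a hypergraph \<Rightarrow> ('a \<times> 'a) set" where
  "adjacency G = {(u, v). \<exists>e\<in>edges G. u \<in> e \<and> v \<in> e}"

definition connected_hypergraph :: "'a hypergraph \<Rightarrow> bool" where
  "connected_hypergraph G \<longleftrightarrow>
     (\<forall>u\<in>verts G. \<forall>v\<in>verts G. (u, v) \<in> (adjacency G)\<^sup>*)"

definition vertex_degree :: "'a hypergraph \<Rightarrow> 'a \<Rightarrow> nat" where
  "vertex_degree G u = card {e \<in> edges G. u \<in> e}"

definition min_degree :: "'a hypergraph \<Rightarrow> nat" where
  "min_degree G = Min (vertex_degree G ` verts G)"

definition delete_vertex :: "'a hypergraph \<Rightarrow> 'a \<Rightarrow> 'a hypergraph" where
  "delete_vertex G v = \<lparr>verts = verts G - {v}, edges = {e \<in> edges G. v \<notin> e}\<rparr>"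

text \<open>A tensor of order \<open>m\<close> with index set \<open>V\<close> is a function on index lists; only its
  values at lists of length \<open>m\<close> over \<open>V\<close> matter. Likewise only the values of a vector
  on \<open>V\<close> matter, so a nonzero vector is one that does not vanish identically on \<open>V\<close>.\<close>

definition tensor_eigenpair ::
    "nat \<Rightarrow> 'a set \<Rightarrow> ('a list \<Rightarrow> complex) \<Rightarrow> complex \<Rightarrow> ('a \<Rightarrow> complex) \<Rightarrow> bool" where
  "tensor_eigenpair m V T \<mu> x \<longleftrightarrow>
     (\<exists>u\<in>V. x u \<noteq> 0) \<and>
     (\<forall>u\<in>V. \<mu> * x u ^ (m - 1) =
        (\<Sum>is | set is \<subseteq> V \<and> length is = m - 1. T (u # is) * prod_list (map x is)))"

definition adjacency_tensor :: "nat \<Rightarrow> 'a hypergraph \<Rightarrow> 'a list \<Rightarrow> complex" where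
  "adjacency_tensor k G is = (if set is \<in> edges G then 1 / fact (k - 1) else 0)"

definition hypergraph_eigenvalue :: "nat \<Rightarrow> 'a hypergraph \<Rightarrow> complex \<Rightarrow> bool" where
  "hypergraph_eigenvalue k G \<mu> \<longleftrightarrow>
     (\<exists>x. tensor_eigenpair k (verts G) (adjacency_tensor k G) \<mu> x)"

text \<open>\<open>GREATEST\<close> is meaningful when the largest modulus is attained. It is for a
  uniform hypergraph with a vertex and \<open>k \<ge> 2\<close>: normalising eigenvectors, the set of
  eigenvalues is a continuous image of a compact set, and it is nonempty.\<close>

definition hypergraph_spectral_radius :: "nat \<Rightarrow> 'a hypergraph \<Rightarrow> real" where
  "hypergraph_spectral_radius k G =
     (GREATEST r. \<exists>\<mu>. hypergraph_eigenvalue k G \<mu> \<and> r = cmod \<mu>)"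

definition max_deleted_radius :: "nat \<Rightarrow> 'a hypergraph \<Rightarrow> real" where
  "max_deleted_radius k G =
     Max ((\<lambda>v. hypergraph_spectral_radius k (delete_vertex G v)) ` verts G)"

definition steiner_system_2 :: "nat \<Rightarrow> nat \<Rightarrow> 'a hypergraph \<Rightarrow> bool" where
  "steiner_system_2 k n G \<longleftrightarrow>
     2 \<le> k \<and> k \<le> n \<and> k_uniform k G \<and> card (verts G) = n \<and>
     (\<forall>P. P \<subseteq> verts G \<and> card P = 2 \<longrightarrow> (\<exists>!e. e \<in> edges G \<and> P \<subseteq> e))"

text \<open>For the adjacency tensor the eigenvalue equations take the familiar form of a sum over
  the edges at \<open>u\<close>: each edge arises from \<open>(k - 1)!\<close> index lists.\<close>

lemma adjacency_tensor_apply: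
  assumes unif: "k_uniform k G" and k: "k \<ge> 1" and u: "u \<in> verts G"
  shows "(\<Sum>is | set is \<subseteq> verts G \<and> length is = k - 1.
            adjacency_tensor k G (u # is) * prod_list (map x is)) =
         (\<Sum>e | e \<in> edges G \<and> u \<in> e. \<Prod>w\<in>e - {u}. x w)"
proof -
  let ?L = "{is. set is \<subseteq> verts G \<and> length is = k - 1}"
  let ?E = "{e. e \<in> edges G \<and> u \<in> e}"
  have finV: "finite (verts G)" using unif by (simp add: k_uniform_def)
  have sub: "e \<subseteq> verts G \<and> card e = k \<and> finite e" if "e \<in> edges G" for e
    using unif that finite_subset[of e "verts G"] by (simp add: k_uniform_def)
  have finL: "finite ?L" using finV by (rule finite_lists_length_eq)
  have finE: "finite ?E"
    by (rule finite_subset[of _ "Pow (verts G)"]) (use sub finV in auto)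
  have perm: "{is \<in> ?L. set (u # is) = e} = permutations_of_set (e - {u})" if "e \<in> ?E" for e
  proof -
    have c: "card (e - {u}) = k - 1" and fe: "finite e" and ue: "u \<in> e" and ev: "e \<subseteq> verts G"
      using sub[of e] that by auto
    have *: "set is = e - {u} \<and> distinct is"
      if "length is = k - 1" "insert u (set is) = e" for "is"
    proof -
      have s: "e - {u} \<subseteq> set is" using that by auto
      have "card (set is) \<le> k - 1" using that(1) card_length[of "is"] by simp
      then have "e - {u} = set is" using s c by (intro card_seteq) simp_all
      then show ?thesis using c that(1) by (simp add: card_distinct)
    qed
    show ?thesis
    proof (intro equalityI subsetI)
      fix js assume "js \<in> {is \<in> ?L. set (u # is) = e}"
      then show "js \<in> permutations_of_set (e - {u})"
        using *[of js] by (simp add: permutations_of_set_def)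
    next
      fix js assume "js \<in> permutations_of_set (e - {u})"
      then have "set js = e - {u}" "distinct js" by (auto simp: permutations_of_set_def)
      then show "js \<in> {is \<in> ?L. set (u # is) = e}"
        using ue ev c distinct_card[of js] by auto
    qed
  qed
  have inner: "(\<Sum>is | is \<in> ?L \<and> set (u # is) = e.
                 adjacency_tensor k G (u # is) * prod_list (map x is)) =
               (\<Prod>w\<in>e - {u}. x w)" if e: "e \<in> ?E" for e
  proof -
    have c: "card (e - {u}) = k - 1" and fe: "finite e" using sub[of e] e by auto
    have "(\<Sum>is | is \<in> ?L \<and> set (u # is) = e.
            adjacency_tensor k G (u # is) * prod_list (map x is)) =
          (\<Sum>is\<in>permutations_of_set (e - {u}). 1 / fact (k - 1) * (\<Prod>w\<in>e - {u}. x w))"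
    proof (rule sum.cong)
      show "{is. is \<in> ?L \<and> set (u # is) = e} = permutations_of_set (e - {u})"
        by (rule perm[OF e])
    next
      fix js assume j: "js \<in> permutations_of_set (e - {u})"
      then have "set (u # js) = e" using e by (auto simp: permutations_of_set_def)
      moreover have "prod_list (map x js) = (\<Prod>w\<in>e - {u}. x w)"
        using prod.distinct_set_conv_list[of js x] permutations_of_setD[OF j] by simp
      ultimately show "adjacency_tensor k G (u # js) * prod_list (map x js) =
          1 / fact (k - 1) * (\<Prod>w\<in>e - {u}. x w)"
        using e by (simp add: adjacency_tensor_def del: list.set)
    qed
    also have "\<dots> = (\<Prod>w\<in>e - {u}. x w)" using c fe by simp
    finally show ?thesis .
  qed
  have "(\<Sum>is\<in>?L. adjacency_tensor k G (u # is) * prod_list (map x is)) =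
        (\<Sum>is | is \<in> ?L \<and> set (u # is) \<in> ?E.
           adjacency_tensor k G (u # is) * prod_list (map x is))"
    using finL by (intro sum.mono_neutral_right) (auto simp: adjacency_tensor_def)
  also have "\<dots> = (\<Sum>e\<in>?E. \<Sum>is | is \<in> {is \<in> ?L. set (u # is) \<in> ?E} \<and> set (u # is) = e.
           adjacency_tensor k G (u # is) * prod_list (map x is))"
    by (rule sum.group[symmetric]) (use finE in \<open>auto intro: finite_subset[OF _ finL]\<close>)
  also have "\<dots> = (\<Sum>e\<in>?E. \<Prod>w\<in>e - {u}. x w)"
  proof (rule sum.cong[OF refl])
    fix e assume e: "e \<in> ?E"
    have "{is. is \<in> {is \<in> ?L. set (u # is) \<in> ?E} \<and> set (u # is) = e} =
          {is. is \<in> ?L \<and> set (u # is) = e}" using e by auto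
    then show "(\<Sum>is | is \<in> {is \<in> ?L. set (u # is) \<in> ?E} \<and> set (u # is) = e.
           adjacency_tensor k G (u # is) * prod_list (map x is)) = (\<Prod>w\<in>e - {u}. x w)"
      using inner[OF e] by simp
  qed
  finally show ?thesis .
qed

lemma hypergraph_eigenvalue_iff:
  assumes "k_uniform k G" and "k \<ge> 1"
  shows "hypergraph_eigenvalue k G \<mu> \<longleftrightarrow>
     (\<exists>x. (\<exists>u\<in>verts G. x u \<noteq> 0) \<and>
        (\<forall>u\<in>verts G. \<mu> * x u ^ (k - 1) =
           (\<Sum>e | e \<in> edges G \<and> u \<in> e. \<Prod>w\<in>e - {u}. x w)))"
  using adjacency_tensor_apply[OF assms]
  by (simp add: hypergraph_eigenvalue_def tensor_eigenpair_def)

end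

theory Submission
  imports Defs "HOL-Analysis.Function_Topology" "HOL-Analysis.Convex"
begin

text \<open>
  The spectral radius \<open>\<rho>\<close> of a \<open>k\<close>-uniform hypergraph is the maximum of the edge polynomial
  \<open>P x = k \<cdot> (\<Sum>e. \<Prod>w\<in>e. x w)\<close> over the nonnegative vectors with \<open>\<Sum>u. x u ^ k = 1\<close>, and a maximiser
  \<open>x\<close> is an eigenvector for \<open>\<rho>\<close> (\<open>spectral_radius_variational\<close>). Delete a vertex \<open>m\<close> at which \<open>x\<close> is
  smallest and put \<open>y = x m ^ k\<close>. By the eigenvalue equation at \<open>m\<close>, the edges at \<open>m\<close> contribute
  \<open>k \<rho> y\<close> to \<open>P x = \<rho>\<close>, so testing \<open>P\<close> of \<open>G - m\<close> with the restriction of \<open>x\<close> gives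
  \<open>\<rho> (1 - k y) \<le> \<rho>(G - m) (1 - y)\<close> (\<open>spectral_radius_delete_vertex_ge\<close>). With
  \<open>c ^ (k - 1) = \<delta> / \<rho>\<close>, the bound \<open>\<rho> - c \<le> \<rho>(G - m)\<close> follows from \<open>(k - 1) \<rho> y \<le> c (1 - y)\<close>.

  To prove the last inequality, take a vertex \<open>v\<close> of minimum degree. For each edge \<open>e\<close> at \<open>v\<close> apply the
  AM-GM inequality to the \<open>k\<close>th powers of \<open>x m / c\<close> and of the entries of \<open>x\<close> on \<open>e - {v}\<close>, and sum
  over these edges. The value of \<open>c\<close> is the one for which the terms \<open>(x m / c) ^ k\<close> add up to
  \<open>\<rho> y / c\<close>, and what remains is \<open>(k - 1) \<rho> y \<le> c S\<close>, where \<open>S\<close> is the sum of \<open>x w ^ k\<close> over the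
  neighbours \<open>w\<close> of \<open>v\<close> (\<open>min_entry_le_neighbourhood_sum\<close>). Linearity makes these \<open>\<delta> (k - 1)\<close> distinct
  vertices, at most \<open>n - 1\<close> in number, so \<open>S \<le> 1 - (n - \<delta> (k - 1)) y \<le> 1 - y\<close>.

  Further, \<open>c \<le> 1\<close> because \<open>\<rho>\<close> is at least the average degree. If \<open>\<rho>(G - m) \<le> \<rho> - c\<close>, then all
  these estimates are equalities, and since \<open>y > 0\<close> the last one forces \<open>\<delta> (k - 1) = n - 1\<close>: every
  vertex is adjacent to all others, which for a linear hypergraph means being a Steiner system.
  Conversely a Steiner system is regular of some degree \<open>d\<close>, and deleting a vertex lowers every
  other degree by one. A regular hypergraph has its degree as spectral radius, so \<open>\<rho> = \<delta> = d\<close>,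
  \<open>c = 1\<close> and \<open>\<gamma> = d - 1\<close>.\<close>

section \<open>Uniform hypergraphs and their edge polynomials\<close>

definition link_sum :: "'a hypergraph \<Rightarrow> ('a \<Rightarrow> real) \<Rightarrow> 'a \<Rightarrow> real" where
  "link_sum G x u = (\<Sum>e | e \<in> edges G \<and> u \<in> e. \<Prod>w\<in>e - {u}. x w)"

text \<open>The factor \<open>k\<close> is chosen such that a normalised eigenvector takes its eigenvalue as value of
  the form.\<close>

definition edge_form :: "nat \<Rightarrow> 'a hypergraph \<Rightarrow> ('a \<Rightarrow> real) \<Rightarrow> real" where
  "edge_form k G x = real k * (\<Sum>e\<in>edges G. \<Prod>w\<in>e. x w)"

lemma k_uniformD:
  assumes "k_uniform k G"
  shows "finite (verts G)" and "finite (edges G)"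
    and "e \<in> edges G \<Longrightarrow> e \<subseteq> verts G"
    and "e \<in> edges G \<Longrightarrow> card e = k"
    and "e \<in> edges G \<Longrightarrow> finite e"
proof -
  show fin: "finite (verts G)" using assms by (simp add: k_uniform_def)
  show sub: "e \<in> edges G \<Longrightarrow> e \<subseteq> verts G" for e using assms by (simp add: k_uniform_def)
  show "e \<in> edges G \<Longrightarrow> card e = k" using assms by (simp add: k_uniform_def)
  show "finite (edges G)" by (rule finite_subset[of _ "Pow (verts G)"]) (use fin sub in auto)
  show "e \<in> edges G \<Longrightarrow> finite e" using fin sub finite_subset by blast
qed

lemma sum_over_incidences:
  fixes f :: "'a \<Rightarrow> 'a set \<Rightarrow> real"
  assumes "k_uniform k G"
  shows "(\<Sum>u\<in>verts G. \<Sum>e | e \<in> edges G \<and> u \<in> e. f u e) = (\<Sum>e\<in>edges G. \<Sum>u\<in>e. f u e)"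
proof -
  have "(\<Sum>u\<in>verts G. \<Sum>e | e \<in> edges G \<and> u \<in> e. f u e) =
        (\<Sum>e\<in>edges G. \<Sum>u | u \<in> verts G \<and> u \<in> e. f u e)"
    by (rule sum.swap_restrict) (use k_uniformD[OF assms] in auto)
  also have "\<dots> = (\<Sum>e\<in>edges G. \<Sum>u\<in>e. f u e)"
    by (intro sum.cong refl) (use k_uniformD(3)[OF assms] in auto)
  finally show ?thesis .
qed

lemma sum_incident_edges_const:
  "(\<Sum>e | e \<in> edges G \<and> u \<in> e. c) = real (vertex_degree G u) * c"
  by (simp add: vertex_degree_def)

text \<open>Euler's identity for the edge polynomial, which is homogeneous of degree \<open>k\<close> and has
  the gradient \<open>k \<cdot> link_sum\<close>.\<close>

lemma sum_link_sum_eq_edge_form: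
  assumes "k_uniform k G"
  shows "(\<Sum>u\<in>verts G. x u * link_sum G x u) = edge_form k G x"
proof -
  have "(\<Sum>u\<in>verts G. x u * link_sum G x u) =
        (\<Sum>u\<in>verts G. \<Sum>e | e \<in> edges G \<and> u \<in> e. x u * (\<Prod>w\<in>e - {u}. x w))"
    by (simp add: link_sum_def sum_distrib_left)
  also have "\<dots> = (\<Sum>e\<in>edges G. \<Sum>u\<in>e. x u * (\<Prod>w\<in>e - {u}. x w))"
    by (rule sum_over_incidences[OF assms])
  also have "\<dots> = (\<Sum>e\<in>edges G. \<Sum>u\<in>e. \<Prod>w\<in>e. x w)"
    by (intro sum.cong refl) (use k_uniformD(5)[OF assms] in \<open>simp add: prod.remove[symmetric]\<close>)
  also have "\<dots> = edge_form k G x"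
    using k_uniformD(4)[OF assms] by (simp add: edge_form_def sum_distrib_left)
  finally show ?thesis .
qed

text \<open>The edge polynomial is affine in each variable, because no edge repeats a vertex.\<close>

lemma edge_form_update:
  assumes "k_uniform k G"
  shows "edge_form k G (x(u := s)) = edge_form k G x + real k * (s - x u) * link_sum G x u"
proof -
  let ?I = "{e \<in> edges G. u \<in> e}"
  have fin: "finite (edges G)" by (rule k_uniformD(2)[OF assms])
  have split: "(\<Sum>e\<in>edges G. \<Prod>w\<in>e. z w) = (\<Sum>e\<in>edges G - ?I. \<Prod>w\<in>e. z w) + z u * link_sum G z u"
    for z :: "'a \<Rightarrow> real"
  proof -
    have "(\<Sum>e\<in>?I. \<Prod>w\<in>e. z w) = (\<Sum>e\<in>?I. z u * (\<Prod>w\<in>e - {u}. z w))"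
      by (intro sum.cong refl) (use k_uniformD(5)[OF assms] in \<open>simp add: prod.remove[symmetric]\<close>)
    then show ?thesis
      by (subst sum.subset_diff[of ?I]) (use fin in \<open>auto simp: link_sum_def sum_distrib_left\<close>)
  qed
  have "(\<Prod>w\<in>e. (x(u := s)) w) = (\<Prod>w\<in>e. x w)" if "u \<notin> e" for e
    using that by (intro prod.cong) auto
  then have "(\<Sum>e\<in>edges G - ?I. \<Prod>w\<in>e. (x(u := s)) w) = (\<Sum>e\<in>edges G - ?I. \<Prod>w\<in>e. x w)"
    by (intro sum.cong) auto
  moreover have "link_sum G (x(u := s)) u = link_sum G x u"
    unfolding link_sum_def by (intro sum.cong prod.cong) auto
  ultimately show ?thesis
    unfolding edge_form_def split[of x] split[of "x(u := s)"]
    by (simp del: fun_upd_apply add: fun_upd_same algebra_simps)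
qed

lemma edge_form_scale:
  assumes "k_uniform k G"
  shows "edge_form k G (\<lambda>u. c * x u) = c ^ k * edge_form k G x"
  using k_uniformD(4)[OF assms] by (simp add: edge_form_def prod.distrib sum_distrib_left mult_ac)

lemma edge_form_cong:
  assumes "k_uniform k G" and "\<And>u. u \<in> verts G \<Longrightarrow> x u = y u"
  shows "edge_form k G x = edge_form k G y"
proof -
  have "(\<Prod>w\<in>e. x w) = (\<Prod>w\<in>e. y w)" if "e \<in> edges G" for e
    using k_uniformD(3)[OF assms(1) that] assms(2) by (intro prod.cong) auto
  then show ?thesis by (simp add: edge_form_def)
qed

lemma link_sum_nonneg:
  assumes "k_uniform k G" and "\<And>u. u \<in> verts G \<Longrightarrow> 0 \<le> x u"
  shows "0 \<le> link_sum G x u"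
  unfolding link_sum_def
  by (intro sum_nonneg prod_nonneg) (use k_uniformD(3)[OF assms(1)] assms(2) in auto)

lemma power_split_one:
  fixes a :: real
  assumes "k \<ge> 1"
  shows "a ^ k = a * a ^ (k - 1)"
  using assms by (cases k) auto

lemma AM_GM_powers:
  fixes x :: "'a \<Rightarrow> real"
  assumes "finite S" and "S \<noteq> {}" and nn: "\<And>i. i \<in> S \<Longrightarrow> 0 \<le> x i"
  shows "real (card S) * (\<Prod>i\<in>S. x i) \<le> (\<Sum>i\<in>S. x i ^ card S)"
proof -
  let ?k = "card S"
  have k: "?k > 0" using assms by (simp add: card_gt_0_iff)
  have P: "0 \<le> (\<Prod>i\<in>S. x i)" by (intro prod_nonneg nn)
  have "(\<Prod>i\<in>S. x i) = ((\<Prod>i\<in>S. x i) ^ ?k) powr (1 / ?k)"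
  proof (cases "(\<Prod>i\<in>S. x i) = 0")
    case False
    then have "0 < (\<Prod>i\<in>S. x i)" using P by simp
    then have "((\<Prod>i\<in>S. x i) ^ ?k) powr (1 / ?k) = (\<Prod>i\<in>S. x i) powr (?k * (1 / ?k))"
      by (simp only: powr_realpow[symmetric] powr_powr)
    then show ?thesis using k P by simp
  qed (use k in simp)
  also have "\<dots> = (\<Prod>i\<in>S. x i ^ ?k) powr (1 / ?k)" by (simp add: prod_power_distrib)
  also have "\<dots> \<le> (\<Sum>i\<in>S. x i ^ ?k / ?k)"
    using assms by (intro arith_geom_mean) auto
  also have "\<dots> = (\<Sum>i\<in>S. x i ^ ?k) / ?k" by (simp add: sum_divide_distrib)
  finally show ?thesis using k by (simp add: field_simps)
qed

text \<open>The AM-GM inequality on each edge charges the edge to the powers \<open>x u ^ k\<close> of its own vertices,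
  so a vertex is charged once for each edge at it. For regular hypergraphs this bounds the
  spectral radius by the degree.\<close>

lemma edge_form_le_degree_sum:
  assumes "k_uniform k G" and k: "k \<ge> 1" and nn: "\<And>u. u \<in> verts G \<Longrightarrow> 0 \<le> x u"
  shows "edge_form k G x \<le> (\<Sum>u\<in>verts G. real (vertex_degree G u) * x u ^ k)"
proof -
  have "edge_form k G x = (\<Sum>e\<in>edges G. real k * (\<Prod>w\<in>e. x w))"
    by (simp add: edge_form_def sum_distrib_left)
  also have "\<dots> \<le> (\<Sum>e\<in>edges G. \<Sum>u\<in>e. x u ^ k)"
  proof (rule sum_mono)
    fix e assume e: "e \<in> edges G"
    have "card e = k" "finite e" "e \<subseteq> verts G" using k_uniformD[OF assms(1)] e by auto
    moreover from this k have "e \<noteq> {}" by auto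
    ultimately show "real k * (\<Prod>w\<in>e. x w) \<le> (\<Sum>u\<in>e. x u ^ k)"
      using AM_GM_powers[of e x] nn by auto
  qed
  also have "\<dots> = (\<Sum>u\<in>verts G. \<Sum>e | e \<in> edges G \<and> u \<in> e. x u ^ k)"
    by (rule sum_over_incidences[OF assms(1), symmetric])
  finally show ?thesis by (simp only: sum_incident_edges_const)
qed

lemma edge_form_one:
  assumes "k_uniform k G"
  shows "edge_form k G (\<lambda>_. 1) = (\<Sum>u\<in>verts G. real (vertex_degree G u))"
proof -
  have "edge_form k G (\<lambda>_. 1) = (\<Sum>u\<in>verts G. link_sum G (\<lambda>_. 1) u)"
    using sum_link_sum_eq_edge_form[OF assms, of "\<lambda>_. 1"] by simp
  then show ?thesis by (simp add: link_sum_def vertex_degree_def)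
qed

section \<open>The spectral radius as a maximum\<close>

text \<open>Vectors are functions on the whole vertex type. Putting them to zero outside the vertex set
  makes the unit sphere compact in the product topology, by Tychonoff's theorem; homogeneity then
  carries the maximum on the sphere over to all nonnegative vectors.\<close>

lemma edge_form_attains_max:
  assumes "k_uniform k G" and k: "k \<ge> 1" and ne: "verts G \<noteq> {}"
  obtains x :: "'a \<Rightarrow> real" where "\<And>u. 0 \<le> x u" and "(\<Sum>u\<in>verts G. x u ^ k) = 1"
    and "\<And>z. (\<And>u. u \<in> verts G \<Longrightarrow> 0 \<le> z u) \<Longrightarrow>
          edge_form k G z \<le> edge_form k G x * (\<Sum>u\<in>verts G. z u ^ k)"
proof -
  let ?V = "verts G"
  have fin: "finite ?V" by (rule k_uniformD(1)[OF assms(1)])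
  define K where "K = PiE UNIV (\<lambda>u. if u \<in> ?V then {0..1::real} else {0})"
  define S where "S = K \<inter> (\<lambda>x. \<Sum>u\<in>?V. x u ^ k) -` {1}"
  have "compactin (product_topology (\<lambda>_. euclidean) UNIV) K"
    unfolding K_def compactin_PiE by auto
  then have "compact K" by (simp add: euclidean_product_topology)
  moreover have "continuous_on UNIV (\<lambda>x. \<Sum>u\<in>?V. x u ^ k :: real)"
    by (intro continuous_intros continuous_on_product_coordinates)
  then have "closed ((\<lambda>x. \<Sum>u\<in>?V. x u ^ k :: real) -` {1})"
    by (intro closed_vimage) auto
  ultimately have S: "compact S" unfolding S_def by (rule compact_Int_closed)
  obtain u0 where u0: "u0 \<in> ?V" using ne by auto
  have "(\<Sum>u\<in>?V. (if u = u0 then 1 else 0 :: real) ^ k) = (\<Sum>u\<in>?V. if u = u0 then 1 else 0)"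
    using k by (intro sum.cong) auto
  then have "(\<lambda>u. if u = u0 then 1 else 0) \<in> S"
    using fin u0 by (auto simp: S_def K_def)
  then have "S \<noteq> {}" by auto
  moreover have "continuous_on S (edge_form k G)"
    unfolding edge_form_def
    by (intro continuous_intros continuous_on_subset[OF continuous_on_product_coordinates]) auto
  ultimately obtain x where x: "x \<in> S" "\<And>y. y \<in> S \<Longrightarrow> edge_form k G y \<le> edge_form k G x"
    using continuous_attains_sup[OF S] by blast
  show thesis
  proof
    show "0 \<le> x u" for u
    proof -
      have "x u \<in> (if u \<in> ?V then {0..1} else {0})"
        using x(1) by (auto simp: S_def K_def PiE_iff)
      then show ?thesis by (simp split: if_splits)
    qed
    show "(\<Sum>u\<in>?V. x u ^ k) = 1" using x(1) by (simp add: S_def)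
    fix z :: "'a \<Rightarrow> real" assume z: "\<And>u. u \<in> ?V \<Longrightarrow> 0 \<le> z u"
    define s where "s = (\<Sum>u\<in>?V. z u ^ k)"
    have s: "0 \<le> s" unfolding s_def by (intro sum_nonneg) (use z in auto)
    have zs: "z u ^ k \<le> s" if "u \<in> ?V" for u
      unfolding s_def by (rule member_le_sum) (use that z fin in auto)
    define t where "t = root k s"
    have t: "0 \<le> t" "t ^ k = s" using s k by (auto simp: t_def)
    have zt: "z u \<le> t" if "u \<in> ?V" for u
    proof (rule power_le_imp_le_base)
      show "z u ^ Suc (k - 1) \<le> t ^ Suc (k - 1)" using zs[OF that] t k by simp
    qed (rule t)
    show "edge_form k G z \<le> edge_form k G x * (\<Sum>u\<in>?V. z u ^ k)"
    proof (cases "t = 0")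
      \<comment> \<open>Here \<open>z\<close> vanishes on the vertices and cannot be normalised.\<close>
      case True
      then have "edge_form k G z = edge_form k G (\<lambda>u. 0 * z u)"
        using zt z by (intro edge_form_cong[OF assms(1)]) force
      then show ?thesis using edge_form_scale[OF assms(1), of 0 z] k t True s_def
        by (simp add: power_0_left)
    next
      case False
      then have t0: "0 < t" using t by simp
      define y where "y = (\<lambda>u. if u \<in> ?V then z u / t else 0)"
      have "(\<Sum>u\<in>?V. y u ^ k) = s / t ^ k"
        by (simp add: y_def s_def power_divide sum_divide_distrib)
      then have "y \<in> S" using t0 t z zt by (auto simp: S_def K_def y_def)
      then have "t ^ k * edge_form k G y \<le> t ^ k * edge_form k G x"
        using x(2) t by (intro mult_left_mono) auto
      moreover have "t ^ k * edge_form k G y = edge_form k G z"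
        unfolding edge_form_scale[OF assms(1), symmetric]
        using t0 by (intro edge_form_cong[OF assms(1)]) (auto simp: y_def)
      ultimately show ?thesis using t by (simp add: s_def mult.commute)
    qed
  qed
qed

text \<open>The Lagrange condition of the maximum in one coordinate \<open>a\<close>, with \<open>D\<close> the link sum. For \<open>a > 0\<close> it
  is the vanishing of a derivative. On the boundary \<open>a = 0\<close> only increases of the coordinate are
  possible; they gain \<open>k \<cdot> s \<cdot> D\<close> to first order and cost \<open>R \<cdot> s ^ k\<close>, which is of higher order since
  \<open>k \<ge> 2\<close>, so \<open>D\<close> must vanish.\<close>

lemma one_variable_stationarity:
  fixes a D R :: real
  assumes k: "k \<ge> 2" and a: "0 \<le> a" and D: "0 \<le> D"
    and max: "\<And>s. 0 \<le> s \<Longrightarrow> real k * (s - a) * D \<le> R * (s ^ k - a ^ k)"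
  shows "R * a ^ (k - 1) = D"
proof (cases "a = 0")
  case True
  have "real k * D \<le> R * s" if s: "0 < s" "s \<le> 1" for s
  proof -
    have "real k * D \<le> R" using max[of 1] True k by (simp add: power_0_left)
    then have Rn: "0 \<le> R" using D by (meson mult_nonneg_nonneg of_nat_0_le_iff order_trans)
    have "s * (real k * D) \<le> s * (R * s ^ (k - 1))"
      using max[of s] s True k by (simp add: power_0_left power_split_one[of k s] mult_ac)
    then have "real k * D \<le> R * s ^ (k - 1)" using s by simp
    also have "\<dots> \<le> R * s ^ 1"
      using Rn s k by (intro mult_left_mono power_decreasing) auto
    finally show ?thesis by simp
  qed
  moreover have "\<forall>\<^sub>F s in at_right 0. 0 < s \<and> s \<le> (1::real)"
    by (auto simp: eventually_at_right_field intro!: exI[of _ 1])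
  ultimately have "\<forall>\<^sub>F s in at_right 0. real k * D \<le> R * s"
    by (auto elim: eventually_mono)
  moreover have "((\<lambda>s. R * s) \<longlongrightarrow> R * 0) (at_right 0)" by (intro tendsto_intros)
  ultimately have "real k * D \<le> R * 0" by (intro tendsto_lowerbound) auto
  then have "D = 0" using D k by (simp add: mult_le_0_iff)
  then show ?thesis using True k by simp
next
  case False
  define f where "f s = R * (s ^ k - a ^ k) - real k * (s - a) * D" for s
  have deriv: "(f has_real_derivative R * (real k * a ^ (k - 1)) - real k * D) (at a)"
    unfolding f_def by (auto intro!: derivative_eq_intros)
  have "\<forall>s. \<bar>a - s\<bar> < a \<longrightarrow> f a \<le> f s"
    using max by (auto simp: f_def abs_if split: if_splits)
  then have "R * (real k * a ^ (k - 1)) - real k * D = 0"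
    using DERIV_local_min[OF deriv, of a] False a by simp
  then have "real k * (R * a ^ (k - 1)) = real k * D" by simp
  then show ?thesis using k by simp
qed

text \<open>Taking moduli in the eigenvalue equations turns a complex eigenvector into a nonnegative test
  vector for the edge polynomial.\<close>

lemma cmod_eigenvalue_le:
  assumes "k_uniform k G" and k: "k \<ge> 1"
    and bound: "\<And>z. (\<And>u. u \<in> verts G \<Longrightarrow> 0 \<le> z u) \<Longrightarrow>
          edge_form k G z \<le> R * (\<Sum>u\<in>verts G. z u ^ k)"
    and "hypergraph_eigenvalue k G \<mu>"
  shows "cmod \<mu> \<le> R"
proof -
  let ?V = "verts G"
  obtain x where x: "\<exists>u\<in>?V. x u \<noteq> 0"
    "\<And>u. u \<in> ?V \<Longrightarrow> \<mu> * x u ^ (k - 1) = (\<Sum>e | e \<in> edges G \<and> u \<in> e. \<Prod>w\<in>e - {u}. x w)"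
    using assms(4) hypergraph_eigenvalue_iff[OF assms(1) k] by blast
  define z where "z u = cmod (x u)" for u
  have pos: "0 < (\<Sum>u\<in>?V. z u ^ k)"
    using x(1) k_uniformD(1)[OF assms(1)] by (auto simp: z_def intro: sum_pos2)
  have "cmod \<mu> * z u ^ k \<le> z u * link_sum G z u" if u: "u \<in> ?V" for u
  proof -
    have "cmod \<mu> * z u ^ (k - 1) = cmod (\<mu> * x u ^ (k - 1))"
      by (simp add: norm_mult norm_power z_def)
    also have "\<dots> \<le> (\<Sum>e | e \<in> edges G \<and> u \<in> e. cmod (\<Prod>w\<in>e - {u}. x w))"
      unfolding x(2)[OF u] by (rule norm_sum)
    also have "\<dots> = link_sum G z u" by (simp add: link_sum_def z_def prod_norm)
    finally have "z u * (cmod \<mu> * z u ^ (k - 1)) \<le> z u * link_sum G z u"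
      by (intro mult_left_mono) (auto simp: z_def)
    then show ?thesis by (simp add: power_split_one[OF k, of "z u"] mult_ac)
  qed
  then have "(\<Sum>u\<in>?V. cmod \<mu> * z u ^ k) \<le> (\<Sum>u\<in>?V. z u * link_sum G z u)" by (rule sum_mono)
  then have "cmod \<mu> * (\<Sum>u\<in>?V. z u ^ k) \<le> edge_form k G z"
    by (simp add: sum_distrib_left sum_link_sum_eq_edge_form[OF assms(1)])
  also have "\<dots> \<le> R * (\<Sum>u\<in>?V. z u ^ k)" by (rule bound) (simp add: z_def)
  finally show ?thesis using pos by simp
qed

text \<open>A maximiser of the edge polynomial solves the eigenvalue equations by stationarity in each
  coordinate, so the maximum is an eigenvalue, and no eigenvalue has larger modulus.\<close>

theorem spectral_radius_variational:
  assumes "k_uniform k G" and k: "k \<ge> 2" and ne: "verts G \<noteq> {}"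
  shows "\<exists>x :: 'a \<Rightarrow> real. (\<forall>u. 0 \<le> x u) \<and> (\<Sum>u\<in>verts G. x u ^ k) = 1 \<and>
      (\<forall>u\<in>verts G. hypergraph_spectral_radius k G * x u ^ (k - 1) = link_sum G x u)"
    and "(\<And>u. u \<in> verts G \<Longrightarrow> 0 \<le> z u) \<Longrightarrow>
      edge_form k G z \<le> hypergraph_spectral_radius k G * (\<Sum>u\<in>verts G. z u ^ k)"
proof -
  let ?V = "verts G"
  have fin: "finite ?V" by (rule k_uniformD(1)[OF assms(1)])
  have k1: "k \<ge> 1" using k by simp
  obtain x :: "'a \<Rightarrow> real" where x: "\<And>u. 0 \<le> x u" "(\<Sum>u\<in>?V. x u ^ k) = 1"
    "\<And>z. (\<And>u. u \<in> ?V \<Longrightarrow> 0 \<le> z u) \<Longrightarrow> edge_form k G z \<le> edge_form k G x * (\<Sum>u\<in>?V. z u ^ k)"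
    using edge_form_attains_max[OF assms(1) k1 ne] by blast
  define R where "R = edge_form k G x"
  have R: "0 \<le> R" unfolding R_def sum_link_sum_eq_edge_form[OF assms(1), symmetric]
    by (intro sum_nonneg mult_nonneg_nonneg x link_sum_nonneg[OF assms(1)])
  have stat: "R * x u ^ (k - 1) = link_sum G x u" if u: "u \<in> ?V" for u
  proof (rule one_variable_stationarity[OF k x(1) link_sum_nonneg[OF assms(1) x(1)]])
    fix s :: real assume s: "0 \<le> s"
    \<comment> \<open>Compare \<open>x\<close> with the vector that differs from it at \<open>u\<close> only.\<close>
    have "(\<Sum>w\<in>?V. (x(u := s)) w ^ k) = s ^ k + (\<Sum>w\<in>?V - {u}. x w ^ k)"
      using fin u by (simp add: sum.remove)
    also have "\<dots> = 1 + s ^ k - x u ^ k"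
      using x(2) fin u by (simp add: sum.remove)
    finally have "edge_form k G (x(u := s)) \<le> R * (1 + s ^ k - x u ^ k)"
      using x(3)[of "x(u := s)"] x(1) s by (simp add: R_def)
    then show "real k * (s - x u) * link_sum G x u \<le> R * (s ^ k - x u ^ k)"
      by (simp add: edge_form_update[OF assms(1)] R_def algebra_simps)
  qed
  have "\<exists>u\<in>?V. x u \<noteq> 0"
  proof (rule ccontr)
    assume "\<not> ?thesis"
    then have "(\<Sum>u\<in>?V. x u ^ k) = 0" using k by (intro sum.neutral) auto
    then show False using x(2) by simp
  qed
  moreover have "complex_of_real R * complex_of_real (x u) ^ (k - 1) =
      (\<Sum>e | e \<in> edges G \<and> u \<in> e. \<Prod>w\<in>e - {u}. complex_of_real (x w))" if "u \<in> ?V" for u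
    using arg_cong[OF stat[OF that], of complex_of_real] by (simp add: link_sum_def)
  ultimately have "hypergraph_eigenvalue k G (complex_of_real R)"
    unfolding hypergraph_eigenvalue_iff[OF assms(1) k1]
    by (intro exI[of _ "\<lambda>u. complex_of_real (x u)"]) auto
  then have radius: "hypergraph_spectral_radius k G = R"
    unfolding hypergraph_spectral_radius_def
    using R cmod_eigenvalue_le[OF assms(1) k1] x(3)
    by (intro Greatest_equality) (auto simp: R_def intro!: exI[of _ "complex_of_real R"])
  show "\<exists>x :: 'a \<Rightarrow> real. (\<forall>u. 0 \<le> x u) \<and> (\<Sum>u\<in>?V. x u ^ k) = 1 \<and>
      (\<forall>u\<in>?V. hypergraph_spectral_radius k G * x u ^ (k - 1) = link_sum G x u)"
    using x stat radius by (intro exI[of _ x]) simp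
  show "(\<And>u. u \<in> ?V \<Longrightarrow> 0 \<le> z u) \<Longrightarrow>
      edge_form k G z \<le> hypergraph_spectral_radius k G * (\<Sum>u\<in>?V. z u ^ k)"
    using x(3)[of z] by (simp add: radius R_def)
qed

text \<open>The constant vector as test vector shows that the average degree is a lower bound.\<close>

lemma spectral_radius_ge_of_min_degree:
  assumes "k_uniform k G" and k: "k \<ge> 2" and ne: "verts G \<noteq> {}"
    and "\<And>u. u \<in> verts G \<Longrightarrow> d \<le> vertex_degree G u"
  shows "real d \<le> hypergraph_spectral_radius k G"
proof -
  let ?n = "real (card (verts G))"
  have "?n > 0" using k_uniformD(1)[OF assms(1)] ne by (simp add: card_gt_0_iff)
  moreover have "real d * ?n \<le> edge_form k G (\<lambda>_. 1)"
    unfolding edge_form_one[OF assms(1)]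
    using sum_mono[of "verts G" "\<lambda>_. real d" "\<lambda>u. real (vertex_degree G u)"] assms(4)
    by (simp add: mult.commute)
  moreover have "edge_form k G (\<lambda>_. 1) \<le> hypergraph_spectral_radius k G * ?n"
    using spectral_radius_variational(2)[OF assms(1) k ne, of "\<lambda>_. 1"] by simp
  ultimately show ?thesis by (meson mult_le_cancel_right_pos order_trans)
qed

lemma spectral_radius_regular:
  assumes "k_uniform k G" and k: "k \<ge> 2" and ne: "verts G \<noteq> {}"
    and reg: "\<And>u. u \<in> verts G \<Longrightarrow> vertex_degree G u = d"
  shows "hypergraph_spectral_radius k G = real d"
proof (rule antisym)
  show "real d \<le> hypergraph_spectral_radius k G"
    by (rule spectral_radius_ge_of_min_degree[OF assms(1) k ne]) (simp add: reg)
  obtain x :: "'a \<Rightarrow> real" where x: "\<And>u. 0 \<le> x u" "(\<Sum>u\<in>verts G. x u ^ k) = 1"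
    "\<And>u. u \<in> verts G \<Longrightarrow> hypergraph_spectral_radius k G * x u ^ (k - 1) = link_sum G x u"
    using spectral_radius_variational(1)[OF assms(1) k ne] by blast
  have "hypergraph_spectral_radius k G = (\<Sum>u\<in>verts G. hypergraph_spectral_radius k G * x u ^ k)"
    using x(2) by (simp add: sum_distrib_left[symmetric])
  also have "\<dots> = (\<Sum>u\<in>verts G. x u * link_sum G x u)"
  proof (intro sum.cong refl)
    fix u assume u: "u \<in> verts G"
    show "hypergraph_spectral_radius k G * x u ^ k = x u * link_sum G x u"
      unfolding x(3)[OF u, symmetric] using k by (simp add: power_split_one[of k "x u"])
  qed
  also have "\<dots> \<le> (\<Sum>u\<in>verts G. real (vertex_degree G u) * x u ^ k)"
    unfolding sum_link_sum_eq_edge_form[OF assms(1)]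
    by (rule edge_form_le_degree_sum[OF assms(1)]) (use k x(1) in auto)
  also have "\<dots> = real d" using x(2) by (simp add: reg sum_distrib_left[symmetric])
  finally show "hypergraph_spectral_radius k G \<le> real d" .
qed

section \<open>Neighbourhoods in linear hypergraphs\<close>

definition neighbourhood :: "'a hypergraph \<Rightarrow> 'a \<Rightarrow> 'a set" where
  "neighbourhood G u = (\<Union>e\<in>{e \<in> edges G. u \<in> e}. e - {u})"

lemma linear_edge_unique:
  assumes "k_uniform k G" and "linear_hypergraph G"
    and "e \<in> edges G" "f \<in> edges G" "u \<in> e" "u \<in> f" "w \<in> e" "w \<in> f" "u \<noteq> w"
  shows "e = f"
proof (rule ccontr)
  assume "e \<noteq> f"
  then have "card (e \<inter> f) \<le> 1" using assms by (simp add: linear_hypergraph_def)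
  moreover have "finite (e \<inter> f)" using k_uniformD(5)[OF assms(1,3)] by simp
  then have "card {u, w} \<le> card (e \<inter> f)" by (rule card_mono) (use assms in auto)
  ultimately show False using \<open>u \<noteq> w\<close> by simp
qed

lemma neighbourhood_subset:
  assumes "k_uniform k G"
  shows "neighbourhood G u \<subseteq> verts G - {u}"
  using k_uniformD(3)[OF assms] by (auto simp: neighbourhood_def)

text \<open>In a linear hypergraph two edges at \<open>u\<close> share no other vertex, so the neighbourhood is a
  disjoint union.\<close>

lemma sum_neighbourhood:
  fixes f :: "'a \<Rightarrow> real"
  assumes "k_uniform k G" and "linear_hypergraph G"
  shows "(\<Sum>w\<in>neighbourhood G u. f w) = (\<Sum>e | e \<in> edges G \<and> u \<in> e. \<Sum>w\<in>e - {u}. f w)"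
  unfolding neighbourhood_def
proof (rule sum.UNION_disjoint)
  show "finite {e \<in> edges G. u \<in> e}" using k_uniformD(2)[OF assms(1)] by simp
  show "\<forall>e\<in>{e \<in> edges G. u \<in> e}. finite (e - {u})" using k_uniformD(5)[OF assms(1)] by simp
  show "\<forall>e\<in>{e \<in> edges G. u \<in> e}. \<forall>f\<in>{e \<in> edges G. u \<in> e}.
          e \<noteq> f \<longrightarrow> (e - {u}) \<inter> (f - {u}) = {}"
  proof (intro ballI impI)
    fix e f assume ef: "e \<in> {e \<in> edges G. u \<in> e}" "f \<in> {e \<in> edges G. u \<in> e}" "e \<noteq> f"
    have False if "w \<in> e" "w \<in> f" "u \<noteq> w" for w
      using linear_edge_unique[OF assms, of e f u w] ef that by simp
    then show "(e - {u}) \<inter> (f - {u}) = {}" by auto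
  qed
qed

lemma card_neighbourhood:
  assumes "k_uniform k G" and "linear_hypergraph G"
  shows "card (neighbourhood G u) = vertex_degree G u * (k - 1)"
proof -
  have "real (card (neighbourhood G u)) = (\<Sum>e | e \<in> edges G \<and> u \<in> e. \<Sum>w\<in>e - {u}. 1)"
    using sum_neighbourhood[OF assms, of "\<lambda>_. 1" u] by simp
  also have "\<dots> = (\<Sum>e | e \<in> edges G \<and> u \<in> e. real (k - 1))"
    by (intro sum.cong refl) (use k_uniformD(4,5)[OF assms(1)] in auto)
  also have "\<dots> = real (vertex_degree G u * (k - 1))" by (simp only: sum_incident_edges_const of_nat_mult)
  finally show ?thesis by (simp only: of_nat_eq_iff)
qed

lemma linear_degree_le:
  assumes "k_uniform k G" and "linear_hypergraph G" and "u \<in> verts G"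
  shows "vertex_degree G u * (k - 1) \<le> card (verts G) - 1"
proof -
  have "card (neighbourhood G u) \<le> card (verts G - {u})"
    by (intro card_mono neighbourhood_subset[OF assms(1)]) (use k_uniformD(1)[OF assms(1)] in simp)
  then show ?thesis using assms(3) by (simp add: card_neighbourhood[OF assms(1,2)])
qed

text \<open>By linearity a pair lies in at most one edge. It lies in some edge exactly when its vertices
  are neighbours, and the largest degree that counting allows means that all other vertices are
  neighbours.\<close>

lemma steiner_system_iff_degrees:
  assumes unif: "k_uniform k G" and lin: "linear_hypergraph G"
    and k: "2 \<le> k" and n: "card (verts G) = n" "k \<le> n"
  shows "steiner_system_2 k n G \<longleftrightarrow> (\<forall>u\<in>verts G. vertex_degree G u * (k - 1) = n - 1)"
proof -
  have fin: "finite (verts G)" by (rule k_uniformD(1)[OF unif])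
  have full: "vertex_degree G u * (k - 1) = n - 1 \<longleftrightarrow> neighbourhood G u = verts G - {u}"
    if "u \<in> verts G" for u
  proof -
    have c: "card (verts G - {u}) = n - 1" using that n(1) by simp
    have "card (neighbourhood G u) = card (verts G - {u}) \<longleftrightarrow> neighbourhood G u = verts G - {u}"
      using card_subset_eq[OF _ neighbourhood_subset[OF unif, of u]] fin
      by (metis finite_Diff)
    then show ?thesis unfolding c card_neighbourhood[OF unif lin] .
  qed
  have pair: "(\<forall>P. P \<subseteq> verts G \<and> card P = 2 \<longrightarrow> (\<exists>!e. e \<in> edges G \<and> P \<subseteq> e)) \<longleftrightarrow>
        (\<forall>u\<in>verts G. neighbourhood G u = verts G - {u})" (is "?L \<longleftrightarrow> ?R")
  proof
    assume L: ?L
    show ?R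
    proof (intro ballI equalityI neighbourhood_subset[OF unif] subsetI)
      fix u w assume "u \<in> verts G" "w \<in> verts G - {u}"
      then have "{u, w} \<subseteq> verts G \<and> card {u, w} = 2" by auto
      then obtain e where "e \<in> edges G" "{u, w} \<subseteq> e" using L by meson
      then show "w \<in> neighbourhood G u"
        using \<open>w \<in> verts G - {u}\<close> by (auto simp: neighbourhood_def)
    qed
  next
    assume R: ?R
    show ?L
    proof (intro allI impI, elim conjE)
      fix P assume "P \<subseteq> verts G" "card P = 2"
      then obtain u w where P: "P = {u, w}" "u \<noteq> w" "u \<in> verts G" "w \<in> verts G"
        by (auto simp: card_2_iff)
      then have "w \<in> neighbourhood G u" using R by auto
      then obtain e where e: "e \<in> edges G" "u \<in> e" "w \<in> e" by (auto simp: neighbourhood_def)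
      show "\<exists>!e. e \<in> edges G \<and> P \<subseteq> e"
      proof (rule ex1I[of _ e])
        show "e \<in> edges G \<and> P \<subseteq> e" using e P by simp
        show "f = e" if "f \<in> edges G \<and> P \<subseteq> f" for f
          by (rule linear_edge_unique[OF unif lin, of f e u w]) (use that e P in auto)
      qed
    qed
  qed
  show ?thesis unfolding steiner_system_2_def pair using full assms by simp
qed

section \<open>Deleting a vertex\<close>

lemma k_uniform_delete_vertex:
  "k_uniform k G \<Longrightarrow> k_uniform k (delete_vertex G v)"
  by (auto simp: k_uniform_def delete_vertex_def)

text \<open>Deleting \<open>v\<close> has the same effect on the edge polynomial as putting \<open>x v\<close> to zero.\<close>

lemma edge_form_delete_vertex:
  assumes "k_uniform k G"
  shows "edge_form k (delete_vertex G v) x = edge_form k G x - real k * x v * link_sum G x v"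
proof -
  have "(\<Sum>e\<in>edges (delete_vertex G v). \<Prod>w\<in>e. x w) =
        (\<Sum>e\<in>edges (delete_vertex G v). \<Prod>w\<in>e. (x(v := 0)) w)"
    by (intro sum.cong prod.cong) (auto simp: delete_vertex_def)
  also have "\<dots> = (\<Sum>e\<in>edges G. \<Prod>w\<in>e. (x(v := 0)) w)"
  proof (rule sum.mono_neutral_left)
    show "\<forall>e\<in>edges G - edges (delete_vertex G v). (\<Prod>w\<in>e. (x(v := 0)) w) = 0"
      using k_uniformD(5)[OF assms] by (auto simp: delete_vertex_def intro!: prod_zero)
  qed (use k_uniformD(2)[OF assms] in \<open>auto simp: delete_vertex_def\<close>)
  finally have "edge_form k (delete_vertex G v) x = edge_form k G (x(v := 0))"
    by (simp only: edge_form_def)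
  then show ?thesis by (simp add: edge_form_update[OF assms])
qed

text \<open>The eigenvalue equation at \<open>v\<close> says how much of the form the edges at \<open>v\<close> carry, so the
  restriction of the eigenvector is a test vector for \<open>G - v\<close> of known value and norm.\<close>

lemma spectral_radius_delete_vertex_ge:
  assumes "k_uniform k G" and k: "k \<ge> 2" and v: "v \<in> verts G" and ne: "verts G - {v} \<noteq> {}"
    and x: "\<And>u. 0 \<le> x u" "(\<Sum>u\<in>verts G. x u ^ k) = 1"
    and eig: "\<And>u. u \<in> verts G \<Longrightarrow> \<rho> * x u ^ (k - 1) = link_sum G x u"
  shows "\<rho> * (1 - real k * x v ^ k) \<le>
         hypergraph_spectral_radius k (delete_vertex G v) * (1 - x v ^ k)"
proof -
  let ?H = "delete_vertex G v"
  have k1: "k \<ge> 1" using k by simp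
  have link: "x u * link_sum G x u = \<rho> * x u ^ k" if "u \<in> verts G" for u
    unfolding eig[OF that, symmetric] by (simp add: power_split_one[OF k1, of "x u"])
  have "edge_form k G x = \<rho>"
    using x(2) by (simp add: sum_link_sum_eq_edge_form[OF assms(1), symmetric] link
        sum_distrib_left[symmetric])
  then have "\<rho> * (1 - real k * x v ^ k) = edge_form k ?H x"
    using link[OF v] by (simp add: edge_form_delete_vertex[OF assms(1)] algebra_simps)
  also have "\<dots> \<le> hypergraph_spectral_radius k ?H * (\<Sum>u\<in>verts ?H. x u ^ k)"
    by (rule spectral_radius_variational(2)[OF k_uniform_delete_vertex[OF assms(1)] k])
      (use ne x(1) in \<open>auto simp: delete_vertex_def\<close>)
  also have "(\<Sum>u\<in>verts ?H. x u ^ k) = 1 - x v ^ k"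
    using x(2) v k_uniformD(1)[OF assms(1)] by (simp add: delete_vertex_def sum_diff1)
  finally show ?thesis .
qed

text \<open>Here \<open>a\<close> is a lower bound for the entry at \<open>v\<close>; it will be the smallest entry of the
  eigenvector. On each edge at \<open>v\<close> the entry at \<open>v\<close> is replaced by \<open>a / c\<close> before the AM-GM inequality
  is applied. The scale \<open>c\<close> is such that the replaced entries contribute
  \<open>deg v \<cdot> (a / c) ^ k = \<rho> \<cdot> a ^ k / c\<close> in total, while by the eigenvalue equation the
  products over the edges add up to at least \<open>\<rho> \<cdot> a ^ k / c\<close>. The products enter with the factor \<open>k\<close>,
  so the difference has the factor \<open>k - 1\<close>.\<close>

lemma min_entry_le_neighbourhood_sum:
  assumes "k_uniform k G" and lin: "linear_hypergraph G" and k: "k \<ge> 2"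
    and v: "v \<in> verts G" and nn: "\<And>u. 0 \<le> x u"
    and eig: "\<rho> * x v ^ (k - 1) = link_sum G x v" and \<rho>: "0 \<le> \<rho>"
    and c: "0 < c" "\<rho> * c ^ (k - 1) = real (vertex_degree G v)"
    and a: "0 \<le> a" "a \<le> x v"
  shows "real (k - 1) * \<rho> * a ^ k \<le> c * (\<Sum>w\<in>neighbourhood G v. x w ^ k)"
proof -
  let ?I = "{e. e \<in> edges G \<and> v \<in> e}" and ?S = "\<Sum>w\<in>neighbourhood G v. x w ^ k"
  have k1: "k \<ge> 1" using k by simp
  have edge: "real k * (a / c * (\<Prod>w\<in>e - {v}. x w)) \<le> (a / c) ^ k + (\<Sum>w\<in>e - {v}. x w ^ k)"
    if e: "e \<in> ?I" for e
  proof -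
    let ?z = "x(v := a / c)"
    have e': "finite e" "e \<noteq> {}" "card e = k" "v \<in> e" using e k_uniformD[OF assms(1)] by auto
    have "(\<Prod>w\<in>e. ?z w) = a / c * (\<Prod>w\<in>e - {v}. ?z w)"
      using e' by (simp add: prod.remove)
    also have "(\<Prod>w\<in>e - {v}. ?z w) = (\<Prod>w\<in>e - {v}. x w)" by (intro prod.cong) auto
    finally have P: "(\<Prod>w\<in>e. ?z w) = a / c * (\<Prod>w\<in>e - {v}. x w)" .
    have "(\<Sum>w\<in>e. ?z w ^ k) = (a / c) ^ k + (\<Sum>w\<in>e - {v}. ?z w ^ k)"
      using e' by (simp add: sum.remove)
    also have "(\<Sum>w\<in>e - {v}. ?z w ^ k) = (\<Sum>w\<in>e - {v}. x w ^ k)" by (intro sum.cong) auto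
    finally have S: "(\<Sum>w\<in>e. ?z w ^ k) = (a / c) ^ k + (\<Sum>w\<in>e - {v}. x w ^ k)" .
    have "real (card e) * (\<Prod>w\<in>e. ?z w) \<le> (\<Sum>w\<in>e. ?z w ^ card e)"
      by (rule AM_GM_powers[OF e'(1,2)]) (use nn a c in simp)
    then show ?thesis unfolding \<open>card e = k\<close> P S .
  qed
  have "real k * (a / c) * (\<rho> * a ^ (k - 1)) \<le> real k * (a / c) * link_sum G x v"
    unfolding eig[symmetric]
    by (intro mult_left_mono power_mono) (use a c \<rho> in auto)
  also have "\<dots> = (\<Sum>e\<in>?I. real k * (a / c * (\<Prod>w\<in>e - {v}. x w)))"
    by (simp add: link_sum_def sum_distrib_left mult_ac)
  also have "\<dots> \<le> (\<Sum>e\<in>?I. (a / c) ^ k + (\<Sum>w\<in>e - {v}. x w ^ k))"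
    by (rule sum_mono[OF edge])
  also have "\<dots> = real (vertex_degree G v) * (a / c) ^ k + ?S"
    by (simp only: sum.distrib sum_incident_edges_const sum_neighbourhood[OF assms(1) lin])
  also have "real (vertex_degree G v) * (a / c) ^ k = \<rho> * a ^ k / c"
    using c(1) by (simp add: c(2)[symmetric] power_divide power_split_one[OF k1, of c])
  finally have "c * (real k * (a / c) * (\<rho> * a ^ (k - 1))) \<le> c * (\<rho> * a ^ k / c + ?S)"
    using c(1) by (intro mult_left_mono) auto
  moreover have "c * (real k * (a / c) * (\<rho> * a ^ (k - 1))) = real k * \<rho> * a ^ k"
    using c(1) by (simp add: power_split_one[OF k1, of a])
  moreover have "c * (\<rho> * a ^ k / c + ?S) = \<rho> * a ^ k + c * ?S"
    using c(1) by (simp add: distrib_left)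
  ultimately have "real k * \<rho> * a ^ k \<le> \<rho> * a ^ k + c * ?S" by simp
  then show ?thesis using k1 by (simp add: of_nat_diff algebra_simps)
qed

text \<open>The vertex to delete is one with the smallest entry of the eigenvector, whereas the AM-GM
  estimate is made at a vertex of minimum degree; the two need not coincide. The second part of the
  conclusion keeps the slack between \<open>1\<close> and \<open>n - \<delta> (k - 1)\<close>, which decides the case of equality.\<close>

proposition exists_vertex_deletion_bound:
  assumes unif: "k_uniform k G" and lin: "linear_hypergraph G" and k: "k \<ge> 2"
    and n: "card (verts G) \<ge> 2" and \<delta>: "min_degree G \<ge> 1"
  defines "\<rho> \<equiv> hypergraph_spectral_radius k G"
  defines "c \<equiv> root (k - 1) (real (min_degree G) / \<rho>)"
  shows "\<exists>m\<in>verts G. \<rho> - c \<le> hypergraph_spectral_radius k (delete_vertex G m) \<and>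
    (hypergraph_spectral_radius k (delete_vertex G m) \<le> \<rho> - c \<longrightarrow>
      card (verts G) - 1 \<le> min_degree G * (k - 1))"
proof -
  let ?V = "verts G"
  define N where "N = card ?V"
  have fin: "finite ?V" by (rule k_uniformD(1)[OF unif])
  have ne: "?V \<noteq> {}" using n by auto
  have deg: "min_degree G \<le> vertex_degree G u" if "u \<in> ?V" for u
    using that fin by (simp add: min_degree_def)
  have \<rho>: "real (min_degree G) \<le> \<rho>"
    unfolding \<rho>_def by (rule spectral_radius_ge_of_min_degree[OF unif k ne deg])
  then have \<rho>0: "0 < \<rho>" using \<delta> by linarith
  have c0: "0 < c" using \<rho>0 \<delta> k by (simp add: c_def)
  have ck: "\<rho> * c ^ (k - 1) = real (min_degree G)"
    using \<rho>0 k by (simp add: c_def)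
  have "min_degree G \<in> vertex_degree G ` ?V"
    unfolding min_degree_def using fin ne by (intro Min_in) auto
  then obtain v where v: "v \<in> ?V" "vertex_degree G v = min_degree G" by auto
  obtain x :: "'a \<Rightarrow> real" where x: "\<And>u. 0 \<le> x u" "(\<Sum>u\<in>?V. x u ^ k) = 1"
    "\<And>u. u \<in> ?V \<Longrightarrow> \<rho> * x u ^ (k - 1) = link_sum G x u"
    using spectral_radius_variational(1)[OF unif k ne] unfolding \<rho>_def by blast
  have "Min (x ` ?V) \<in> x ` ?V" using fin ne by (intro Min_in) auto
  then obtain m where m: "m \<in> ?V" "x m = Min (x ` ?V)" by auto
  have xm: "x m \<le> x u" if "u \<in> ?V" for u using that fin by (simp add: m(2))
  define y where "y = x m ^ k"
  have y0: "0 \<le> y" using x(1) by (simp add: y_def)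
  have ysum: "real (card A) * y \<le> (\<Sum>u\<in>A. x u ^ k)" if "A \<subseteq> ?V" for A
    using sum_mono[of A "\<lambda>_. y" "\<lambda>u. x u ^ k"] xm x(1) that by (auto simp: y_def intro: power_mono)
  \<comment> \<open>At least two vertices carry the total mass \<open>1\<close>, each of them at least \<open>y\<close>.\<close>
  have "real 2 * y \<le> real N * y" using n y0 by (intro mult_right_mono) (auto simp: N_def)
  then have y1: "y < 1" using ysum[of ?V] x(2) by (simp add: N_def)
  let ?d = "real (min_degree G * (k - 1))"
  have nb: "neighbourhood G v \<subseteq> ?V" using neighbourhood_subset[OF unif, of v] by auto
  have "card (?V - neighbourhood G v) = N - min_degree G * (k - 1)"
    using nb fin by (simp add: card_Diff_subset finite_subset card_neighbourhood[OF unif lin] v N_def)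
  moreover have dN: "min_degree G * (k - 1) \<le> N - 1"
    using linear_degree_le[OF unif lin v(1)] by (simp add: v N_def)
  ultimately have cd: "real (card (?V - neighbourhood G v)) = real N - ?d"
    by (simp add: of_nat_diff)
  have "(\<Sum>w\<in>neighbourhood G v. x w ^ k) = 1 - (\<Sum>w\<in>?V - neighbourhood G v. x w ^ k)"
    using sum.subset_diff[OF nb fin, of "\<lambda>w. x w ^ k"] x(2) by simp
  also have "\<dots> \<le> 1 - (real N - ?d) * y"
    using ysum[of "?V - neighbourhood G v"] by (simp add: cd)
  finally have nbsum: "(\<Sum>w\<in>neighbourhood G v. x w ^ k) \<le> 1 - (real N - ?d) * y" .
  have "real (k - 1) * \<rho> * y \<le> c * (\<Sum>w\<in>neighbourhood G v. x w ^ k)"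
    unfolding y_def
    by (rule min_entry_le_neighbourhood_sum[OF unif lin k v(1) x(1) x(3)[OF v(1)] _ c0 _ x(1)])
      (use \<rho>0 ck v xm in auto)
  also have "\<dots> \<le> c * (1 - (real N - ?d) * y)" using nbsum c0 by (intro mult_left_mono) auto
  finally have key: "real (k - 1) * \<rho> * y \<le> c * (1 - (real N - ?d) * y)" .
  have "N \<ge> 2" using n by (simp add: N_def)
  with dN have Nd: "1 \<le> real N - ?d" by linarith
  then have "1 * y \<le> (real N - ?d) * y" using y0 by (intro mult_right_mono)
  then have "c * (1 - (real N - ?d) * y) \<le> c * (1 - y)" using c0 by (intro mult_left_mono) auto
  with key have key': "real (k - 1) * \<rho> * y \<le> c * (1 - y)" by linarith
  let ?\<rho>' = "hypergraph_spectral_radius k (delete_vertex G m)"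
  have "?V - {m} \<noteq> {}"
    using n card_mono[of "{m}" ?V] by auto
  then have "\<rho> * (1 - real k * y) \<le> ?\<rho>' * (1 - y)"
    unfolding y_def by (rule spectral_radius_delete_vertex_ge[OF unif k m(1) _ x(1,2,3)])
  moreover have "\<rho> * (1 - real k * y) = \<rho> * (1 - y) - real (k - 1) * \<rho> * y"
    using k by (simp add: of_nat_diff algebra_simps)
  ultimately have del: "\<rho> * (1 - y) - real (k - 1) * \<rho> * y \<le> ?\<rho>' * (1 - y)" by simp
  show ?thesis
  proof (intro bexI[of _ m] conjI impI)
    show "m \<in> ?V" by (rule m)
    have "(\<rho> - c) * (1 - y) \<le> ?\<rho>' * (1 - y)"
      using del key' by (simp add: left_diff_distrib)
    then show "\<rho> - c \<le> ?\<rho>'" using y1 by simp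
    assume "?\<rho>' \<le> \<rho> - c"
    then have "?\<rho>' * (1 - y) \<le> (\<rho> - c) * (1 - y)" using y1 by (intro mult_right_mono) auto
    with del have eq: "c * (1 - y) \<le> real (k - 1) * \<rho> * y" by (simp add: left_diff_distrib)
    \<comment> \<open>A vanishing smallest entry would give \<open>c \<le> 0\<close>.\<close>
    then have "y \<noteq> 0" using c0 by auto
    then have ypos: "0 < y" using y0 by simp
    have "c * (1 - y) \<le> c * (1 - (real N - ?d) * y)" using eq key by linarith
    then have "(real N - ?d) * y \<le> 1 * y" using c0 by simp
    then have "real N - ?d \<le> 1" using ypos by (simp only: mult_le_cancel_right_pos)
    then have "real N \<le> real (min_degree G * (k - 1) + 1)" by simp
    then show "card ?V - 1 \<le> min_degree G * (k - 1)" by (simp add: of_nat_le_iff N_def del: of_nat_mult of_nat_add)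
  qed
qed

section \<open>Steiner systems and the deletion bound\<close>

text \<open>Exactly one edge at \<open>w\<close> contains \<open>v\<close>, and it is the only one at \<open>w\<close> that is lost.\<close>

lemma steiner_degree_delete_vertex:
  assumes "steiner_system_2 k n G" and "v \<in> verts G" and "w \<in> verts G - {v}"
  shows "vertex_degree (delete_vertex G v) w = vertex_degree G w - 1"
proof -
  have all: "\<forall>P. P \<subseteq> verts G \<and> card P = 2 \<longrightarrow> (\<exists>!e. e \<in> edges G \<and> P \<subseteq> e)"
    using assms(1) unfolding steiner_system_2_def by (elim conjE)
  have "{v, w} \<subseteq> verts G \<and> card {v, w} = 2" using assms(2,3) by auto
  then have "\<exists>!e. e \<in> edges G \<and> {v, w} \<subseteq> e" by (rule all[THEN spec, THEN mp])
  then obtain e where e: "e \<in> edges G \<and> {v, w} \<subseteq> e"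
    and unique: "\<forall>f. f \<in> edges G \<and> {v, w} \<subseteq> f \<longrightarrow> f = e" by (rule ex1E)
  have "{f \<in> edges (delete_vertex G v). w \<in> f} = {f \<in> edges G. w \<in> f} - {e}"
  proof (intro equalityI subsetI)
    fix f assume "f \<in> {f \<in> edges (delete_vertex G v). w \<in> f}"
    then have "f \<in> edges G" "v \<notin> f" "w \<in> f" by (simp_all add: delete_vertex_def)
    then show "f \<in> {f \<in> edges G. w \<in> f} - {e}" using e by auto
  next
    fix f assume "f \<in> {f \<in> edges G. w \<in> f} - {e}"
    then have f: "f \<in> edges G" "w \<in> f" "f \<noteq> e" by simp_all
    then have "v \<notin> f" using unique[THEN spec, of f] by simp
    then show "f \<in> {f \<in> edges (delete_vertex G v). w \<in> f}"
      using f by (simp add: delete_vertex_def)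
  qed
  moreover have "e \<in> {f \<in> edges G. w \<in> f}" using e by simp
  ultimately show ?thesis unfolding vertex_degree_def by (simp only: card_Diff_singleton)
qed

lemma steiner_system_radii:
  assumes S: "steiner_system_2 k n G" and lin: "linear_hypergraph G"
  shows "hypergraph_spectral_radius k G = real (min_degree G)"
    and "max_deleted_radius k G = hypergraph_spectral_radius k G - 1"
proof -
  let ?V = "verts G"
  have unif: "k_uniform k G" and k: "2 \<le> k" and n: "k \<le> n" "card ?V = n"
    using S by (auto simp: steiner_system_2_def)
  have fin: "finite ?V" by (rule k_uniformD(1)[OF unif])
  have ne: "?V \<noteq> {}" using n k by auto
  obtain u0 where u0: "u0 \<in> ?V" using ne by auto
  define d where "d = vertex_degree G u0"
  have all: "vertex_degree G u * (k - 1) = n - 1" if "u \<in> ?V" for u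
    using steiner_system_iff_degrees[OF unif lin k n(2,1)] S that by auto
  have deg: "vertex_degree G u = d" if "u \<in> ?V" for u
    proof -
    have "vertex_degree G u * (k - 1) = d * (k - 1)"
      using all[OF that] all[OF u0] by (simp add: d_def)
    then show ?thesis using k by simp
  qed
  have d1: "d \<ge> 1" using all[OF u0] n k by (cases d) (auto simp: d_def[symmetric])
  have rho: "hypergraph_spectral_radius k G = real d"
    by (rule spectral_radius_regular[OF unif k ne deg])
  have "vertex_degree G ` ?V = {d}" using deg u0 by auto
  then have "min_degree G = d" by (simp add: min_degree_def)
  with rho show "hypergraph_spectral_radius k G = real (min_degree G)" by simp
  have "hypergraph_spectral_radius k (delete_vertex G v) = real (d - 1)" if v: "v \<in> ?V" for v
  proof (rule spectral_radius_regular[OF k_uniform_delete_vertex[OF unif] k])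
    have "card (verts (delete_vertex G v)) = n - 1" using v n by (simp add: delete_vertex_def)
    then have "card (verts (delete_vertex G v)) \<noteq> 0" using n k by linarith
    then show "verts (delete_vertex G v) \<noteq> {}" by (metis card.empty)
    show "vertex_degree (delete_vertex G v) w = d - 1" if "w \<in> verts (delete_vertex G v)" for w
      using steiner_degree_delete_vertex[OF S v, of w] that deg by (simp add: delete_vertex_def)
  qed
  then have "(\<lambda>v. hypergraph_spectral_radius k (delete_vertex G v)) ` ?V = {real (d - 1)}"
    using u0 by force
  then show "max_deleted_radius k G = hypergraph_spectral_radius k G - 1"
    using d1 by (simp add: max_deleted_radius_def rho of_nat_diff)
qed

text \<open>The first step of a path to another vertex lies in an edge. A positive minimum degree is what
  makes \<open>\<rho>\<close> and \<open>\<delta> / \<rho>\<close> positive.\<close>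

lemma connected_min_degree_pos:
  assumes unif: "k_uniform k G" and "connected_hypergraph G" and n: "card (verts G) \<ge> 2"
  shows "min_degree G \<ge> 1"
proof -
  have fin: "finite (verts G)" by (rule k_uniformD(1)[OF unif])
  have "vertex_degree G u \<ge> 1" if u: "u \<in> verts G" for u
  proof -
    have "\<not> verts G \<subseteq> {u}" using n card_mono[of "{u}" "verts G"] by auto
    then obtain w where "w \<in> verts G" "w \<noteq> u" by auto
    then have "(u, w) \<in> (adjacency G)\<^sup>*" "u \<noteq> w"
      using assms(2) u by (auto simp: connected_hypergraph_def)
    then obtain z where "(u, z) \<in> adjacency G" by (meson converse_rtranclE)
    then obtain e where "e \<in> {e \<in> edges G. u \<in> e}" by (auto simp: adjacency_def)
    moreover have "finite {e \<in> edges G. u \<in> e}" using k_uniformD(2)[OF unif] by simp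
    ultimately have "0 < card {e \<in> edges G. u \<in> e}" by (auto simp: card_gt_0_iff)
    then show ?thesis by (simp add: vertex_degree_def)
  qed
  moreover have "verts G \<noteq> {}" using n by auto
  ultimately show ?thesis using fin by (simp add: min_degree_def)
qed

theorem theorem4p6:
  fixes n k :: nat and G :: "nat hypergraph"
  assumes "2 \<le> k" and "k \<le> n"
    and "verts G = {1..n}"
    and "k_uniform k G"
    and "linear_hypergraph G"
    and "connected_hypergraph G"
  defines "\<rho> \<equiv> hypergraph_spectral_radius k G"
    and "\<gamma> \<equiv> max_deleted_radius k G"
    and "\<delta> \<equiv> real (min_degree G)"
  shows "\<gamma> \<ge> \<rho> - root (k - 1) (\<delta> / \<rho>)
    \<and> \<rho> - root (k - 1) (\<delta> / \<rho>) \<ge> \<rho> - 1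
    \<and> (\<gamma> = \<rho> - root (k - 1) (\<delta> / \<rho>) \<longleftrightarrow> steiner_system_2 k n G)
    \<and> (\<gamma> = \<rho> - 1 \<longleftrightarrow> steiner_system_2 k n G)"
proof -
  note k = assms(1) and unif = assms(4) and lin = assms(5)
  let ?V = "verts G" and ?c = "root (k - 1) (\<delta> / \<rho>)"
  have n: "card ?V = n" and fin: "finite ?V" using assms(3) by auto
  have n2: "card ?V \<ge> 2" using n assms(1,2) by simp
  have ne: "?V \<noteq> {}" using n2 by auto
  have d1: "min_degree G \<ge> 1" by (rule connected_min_degree_pos[OF unif assms(6) n2])
  have deg: "min_degree G \<le> vertex_degree G u" if "u \<in> ?V" for u
    using that fin by (simp add: min_degree_def)
  have \<delta>\<rho>: "\<delta> \<le> \<rho>"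
    unfolding \<rho>_def \<delta>_def by (rule spectral_radius_ge_of_min_degree[OF unif k ne deg])
  have \<delta>0: "0 < \<delta>" using d1 by (simp add: \<delta>_def)
  have c1: "?c \<le> 1" using \<delta>\<rho> \<delta>0 k by simp
  obtain m where m: "m \<in> ?V" "\<rho> - ?c \<le> hypergraph_spectral_radius k (delete_vertex G m)"
    "hypergraph_spectral_radius k (delete_vertex G m) \<le> \<rho> - ?c \<Longrightarrow>
       card ?V - 1 \<le> min_degree G * (k - 1)"
    using exists_vertex_deletion_bound[OF unif lin k n2 d1] unfolding \<rho>_def \<delta>_def by blast
  have m\<gamma>: "hypergraph_spectral_radius k (delete_vertex G m) \<le> \<gamma>"
    unfolding \<gamma>_def max_deleted_radius_def using fin m(1) by (intro Max_ge) auto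
  have bound: "\<rho> - ?c \<le> \<gamma>" using m(2) m\<gamma> by linarith
  have steiner: "steiner_system_2 k n G" if "\<gamma> = \<rho> - ?c"
    unfolding steiner_system_iff_degrees[OF unif lin k n assms(2)]
  proof
    fix u assume u: "u \<in> ?V"
    have "n - 1 \<le> min_degree G * (k - 1)" using m(3) m\<gamma> that n by simp
    also have "\<dots> \<le> vertex_degree G u * (k - 1)" by (intro mult_right_mono deg u) simp
    finally show "vertex_degree G u * (k - 1) = n - 1"
      using linear_degree_le[OF unif lin u] n by simp
  qed
  have attained: "\<gamma> = \<rho> - 1" "?c = 1" if "steiner_system_2 k n G"
    using steiner_system_radii[OF that lin] \<delta>0 k by (simp_all add: \<gamma>_def \<rho>_def \<delta>_def)
  show ?thesis
  proof (intro conjI iffI)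
    show "\<rho> - ?c \<le> \<gamma>" by (rule bound)
    show "\<rho> - 1 \<le> \<rho> - ?c" using c1 by simp
    show "steiner_system_2 k n G" if "\<gamma> = \<rho> - ?c" using that by (rule steiner)
    show "\<gamma> = \<rho> - ?c" if "steiner_system_2 k n G" using attained[OF that] by simp
    show "steiner_system_2 k n G" if "\<gamma> = \<rho> - 1" by (rule steiner) (use that bound c1 in linarith)
    show "\<gamma> = \<rho> - 1" if "steiner_system_2 k n G" by (rule attained(1)[OF that])
  qed
qed

end
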